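(* For all integers $n\ge 1$ and $l$ with $1\le l\le n$, $$S_2(n,l)=\sum_{l\le m\le n}\ \sum_{l_1+\cdots+l_n=m-l}\binom{n-1}{m-1}\binom{m-1}{l-1}\frac{n!}{m!}\binom{m-l}{l_1,\ldots,l_n}B_{l_1}^{(l_1)}\cdots B_{l_n}^{(l_n)},$$ where the inner sum is over all $n$-tuples $(l_1,\ldots,l_n)$ of nonnegative integers with $l_1+\cdots+l_n=m-l$.
   Context: For an integer $r\ge 0$, the Bernoulli numbers of order $r$, $B_k^{(r)}$, are defined by $\left(\frac{t}{e^t-1}\right)^r=\sum_{k=0}^{\infty}B_k^{(r)}\frac{t^k}{k!}$ (so $B_0^{(0)}=1$). $S_2(n,l)$ denotes the Stirling numbers of the second kind. $\binom{N}{l_1,\ldots,l_n}=\frac{N!}{l_1!\cdots l_n!}$ is the multinomial coefficient. *)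

theory Defs
  imports
    "HOL-Computational_Algebra.Formal_Power_Series"
    "HOL-Combinatorics.Stirling"
begin

definition bernoulli_gf :: "rat fps" where
  "bernoulli_gf = fps_X / (fps_exp 1 - 1)"

definition bernoulli_order :: "nat \<Rightarrow> nat \<Rightarrow> rat" where
  "bernoulli_order r k = fact k * fps_nth (bernoulli_gf ^ r) k"

definition multinomial :: "nat \<Rightarrow> nat list \<Rightarrow> rat" where
  "multinomial N ls = fact N / (\<Prod>i<length ls. fact (ls ! i))"

(* Both series in the quotient have constant term 0, so the quotient is not
   a multiplication by an inverse in the ring of power series; the next two facts
   confirm that it is the genuine quotient and give the defining expansion. *)

lemma bernoulli_gf_times: "bernoulli_gf * (fps_exp 1 - 1) = fps_X"
proof -
  have nz: "fps_nth (fps_exp 1 - 1 :: rat fps) 1 \<noteq> 0"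
    by simp
  then have "subdegree (fps_exp 1 - 1 :: rat fps) \<le> 1"
    by (rule subdegree_leI)
  moreover have "(fps_exp 1 - 1 :: rat fps) \<noteq> 0"
    using nz by force
  ultimately have "(fps_exp 1 - 1 :: rat fps) dvd fps_X"
    by (simp add: fps_dvd_iff)
  then show ?thesis
    unfolding bernoulli_gf_def by simp
qed

lemma bernoulli_order_egf:
  "bernoulli_gf ^ r = Abs_fps (\<lambda>k. bernoulli_order r k / fact k)"
  by (rule fps_ext) (simp add: bernoulli_order_def)

end

theory Submission
  imports Defs
begin

text \<open>
  Lagrange inversion, in residue form: if \<open>f = X * u\<close> with \<open>u * v = 1\<close>, then
  the coefficient of \<open>X^n\<close> in \<open>(H oo f) * f' * v^(n+1)\<close> is that of \<open>H\<close>.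
  For \<open>f = exp X - 1\<close> it identifies the generating function of the numbers
  \<open>B_k^(k) / k!\<close> as \<open>G = X / ((1 + X) * ln (1 + X))\<close>. For \<open>f = ln (1 + X)\<close> it gives
  \<open>[X^n] (exp X - 1)^l = (l/n) [X^(n-l)] (X / ln (1 + X))^n\<close>, whose left-hand side is
  \<open>l! S(n,l) / n!\<close>. On the other side, \<open>(X / ln (1 + X))^n = (1 + X)^n * G^n\<close> is a
  convolution of binomial coefficients with the multinomial sums.
\<close>

text \<open>As \<open>v = X / f\<close>, the series is \<open>X^(n+1)\<close> times
  \<open>f^(k-n-1) * f'\<close>, so the coefficient is a residue. For \<open>k \<noteq> n\<close>
  the latter is the derivative of \<open>f^(k-n) / (k-n)\<close>, which has residue 0; for
  \<open>k = n\<close> it is \<open>f' / f\<close>, with residue 1.\<close>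

lemma residue_power:
  fixes f u v :: "'a::field_char_0 fps"
  assumes f: "f = fps_X * u" and uv: "u * v = 1"
  shows "fps_nth (f ^ k * fps_deriv f * v ^ Suc n) n = of_bool (k = n)"
proof -
  have df: "fps_deriv f = u + fps_X * fps_deriv u"
    by (simp add: f algebra_simps)
  have shift: "f ^ k * fps_deriv f * v ^ Suc n = fps_X ^ k * (u ^ k * fps_deriv f * v ^ Suc n)"
    by (simp add: f power_mult_distrib algebra_simps)
  have ukvk: "u ^ k * v ^ k = 1"
    by (metis uv power_mult_distrib power_one)
  show ?thesis
  proof (cases k n rule: linorder_cases)
    case less
    define j where "j = n - k"
    have j: "j > 0" and n: "n = k + j"
      using less by (auto simp: j_def)
    \<comment> \<open>After cancelling \<open>X^k\<close>, the coefficient at \<open>j\<close> is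
      wanted. The two summands \<open>v^j\<close> and \<open>X * u' * v^(j+1)\<close> cancel there,
      since \<open>u' * v = - u * v'\<close> turns the second into
      \<open>- X * (v^j)' / j\<close>.\<close>
    have "u ^ k * fps_deriv f * v ^ Suc n = (u ^ k * v ^ k) * (fps_deriv f * v ^ Suc j)"
      by (simp add: n power_add algebra_simps)
    also have "\<dots> = (u * v) * v ^ j + fps_X * (fps_deriv u * v ^ Suc j)"
      by (simp add: df ukvk algebra_simps)
    finally have a: "u ^ k * fps_deriv f * v ^ Suc n = v ^ j + fps_X * (fps_deriv u * v ^ Suc j)"
      by (simp add: uv)
    have "fps_deriv (u * v) = 0"
      by (simp add: uv)
    then have duv: "fps_deriv u * v = - (u * fps_deriv v)"
      by (simp add: eq_neg_iff_add_eq_0 algebra_simps)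
    obtain i where i: "j = Suc i"
      using j by (cases j) auto
    have "fps_deriv u * v ^ Suc j = (fps_deriv u * v) * (v * v ^ i)"
      by (simp add: i algebra_simps)
    also have "\<dots> = - ((u * v) * (fps_deriv v * v ^ i))"
      unfolding duv by (simp add: algebra_simps)
    finally have "fps_const (of_nat j) * (fps_deriv u * v ^ Suc j) = - fps_deriv (v ^ j)"
      by (simp add: uv i fps_deriv_power del: power_Suc)
    from arg_cong[OF this, of "\<lambda>x. fps_nth x i"]
    have "of_nat j * fps_nth (fps_deriv u * v ^ Suc j) i = of_nat j * (- fps_nth (v ^ j) j)"
      by (simp only: fps_mult_left_const_nth fps_neg_nth fps_deriv_nth i Suc_eq_plus1 mult_minus_right)
    then have "fps_nth (fps_deriv u * v ^ Suc j) i = - fps_nth (v ^ j) j"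
      using j by (simp only: mult_cancel_left of_nat_eq_0_iff) simp
    then have "fps_nth (v ^ j + fps_X * (fps_deriv u * v ^ Suc j)) j = 0"
      by (simp add: i del: power_Suc)
    then show ?thesis
      using less unfolding shift a fps_X_power_mult_nth j_def by simp
  next
    case equal
    have "fps_nth u 0 * fps_nth v 0 = 1"
      using arg_cong[OF uv, of "\<lambda>x. fps_nth x 0"] by simp
    moreover have "u ^ k * fps_deriv f * v ^ Suc n = (u ^ k * v ^ k) * (fps_deriv f * v)"
      by (simp add: equal mult_ac)
    then have "u ^ k * fps_deriv f * v ^ Suc n = fps_deriv f * v"
      by (simp only: ukvk mult_1_left)
    ultimately show ?thesis
      unfolding shift fps_X_power_mult_nth by (simp only: equal df) simp
  next
    case greater
    then show ?thesis
      unfolding shift fps_X_power_mult_nth by simp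
  qed
qed

lemma fps_compose_mult_nth:
  fixes f :: "'a::idom fps"
  assumes "fps_nth f 0 = 0"
  shows "fps_nth ((H oo f) * g) n = (\<Sum>i=0..n. fps_nth H i * fps_nth (f ^ i * g) n)"
proof -
  \<comment> \<open>\<open>f^i\<close> has no terms below degree \<open>i\<close>, so raising the
    upper limit from \<open>j\<close> to \<open>n\<close> adds only zeros. A limit independent of
    \<open>j\<close> lets the two sums be swapped.\<close>
  have "fps_nth (H oo f) j = (\<Sum>i=0..n. fps_nth H i * fps_nth (f ^ i) j)" if "j \<le> n" for j
    unfolding fps_compose_nth
    by (rule sum.mono_neutral_left)
      (use that assms in \<open>auto simp: startsby_zero_power_prefix\<close>)
  then have "fps_nth ((H oo f) * g) n
      = (\<Sum>j=0..n. (\<Sum>i=0..n. fps_nth H i * fps_nth (f ^ i) j) * fps_nth g (n - j))"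
    by (simp add: fps_mult_nth)
  also have "\<dots> = (\<Sum>j=0..n. \<Sum>i=0..n. fps_nth H i * (fps_nth (f ^ i) j * fps_nth g (n - j)))"
    by (simp add: sum_distrib_right mult.assoc)
  also have "\<dots> = (\<Sum>i=0..n. \<Sum>j=0..n. fps_nth H i * (fps_nth (f ^ i) j * fps_nth g (n - j)))"
    by (rule sum.swap)
  finally show ?thesis
    by (simp add: fps_mult_nth sum_distrib_left)
qed

lemma residue_compose:
  fixes f u v :: "'a::field_char_0 fps"
  assumes f: "f = fps_X * u" and uv: "u * v = 1"
  shows "fps_nth ((H oo f) * fps_deriv f * v ^ Suc n) n = fps_nth H n"
proof -
  have "fps_nth ((H oo f) * (fps_deriv f * v ^ Suc n)) n
      = (\<Sum>i=0..n. fps_nth H i * fps_nth (f ^ i * fps_deriv f * v ^ Suc n) n)"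
    by (subst fps_compose_mult_nth) (simp_all add: f mult.assoc)
  also have "\<dots> = fps_nth H n"
    by (simp only: residue_power[OF f uv]) (simp add: of_bool_def sum.delta if_distrib cong: if_cong)
  finally show ?thesis
    by (simp add: mult.assoc)
qed

lemma Stirling_egf:
  "fact n * fps_nth ((fps_exp 1 - 1) ^ l) n = (fact l * of_nat (Stirling n l) :: 'a::field_char_0)"
proof (induction n l rule: Stirling.induct)
  case (4 n k)
  let ?E = "fps_exp 1 - 1 :: 'a fps"
  \<comment> \<open>Since \<open>?E' = ?E + 1\<close>, differentiation mirrors the Stirling
    recurrence, up to the factor \<open>fact (Suc k)\<close>.\<close>
  have "fps_deriv (?E ^ Suc k) = fps_const (of_nat (Suc k)) * (?E ^ Suc k + ?E ^ k)"
    unfolding fps_deriv_power by (simp add: algebra_simps)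
  from arg_cong[OF this, of "\<lambda>x. fps_nth x n"]
  have "of_nat (Suc n) * fps_nth (?E ^ Suc k) (Suc n)
      = of_nat (Suc k) * (fps_nth (?E ^ Suc k) n + fps_nth (?E ^ k) n)"
    by (simp del: power_Suc of_nat_Suc)
  then have "fact (Suc n) * fps_nth (?E ^ Suc k) (Suc n)
      = of_nat (Suc k) * (fact n * fps_nth (?E ^ Suc k) n + fact n * fps_nth (?E ^ k) n)"
    by (simp del: power_Suc of_nat_Suc add: algebra_simps)
  also have "\<dots> = fact (Suc k) * of_nat (Stirling (Suc n) (Suc k))"
    unfolding 4 by (simp add: algebra_simps)
  finally show ?case .
qed simp_all

text \<open>\<open>fps_ln 1\<close> is \<open>ln (1 + X)\<close>, with constant term 0. Shifting
  divides it by \<open>X\<close>, which leaves the constant term 1 and hence a unit.\<close>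

definition X_over_ln :: "'a::field_char_0 fps" where
  "X_over_ln = inverse (fps_shift 1 (fps_ln 1))"

lemma ln_quotient_mult_X_over_ln: "fps_shift 1 (fps_ln 1) * X_over_ln = (1 :: 'a::field_char_0 fps)"
  unfolding X_over_ln_def by (rule inverse_mult_eq_1') (simp add: fps_ln_nth)

lemma fps_ln_eq_X_mult: "fps_ln 1 = fps_X * fps_shift 1 (fps_ln 1 :: 'a::field_char_0 fps)"
  by (rule fps_ext) (simp add: fps_X_mult_nth)

lemma fps_ln_mult_X_over_ln: "fps_ln 1 * X_over_ln = (fps_X :: 'a::field_char_0 fps)"
  by (subst fps_ln_eq_X_mult) (simp add: mult.assoc ln_quotient_mult_X_over_ln del: One_nat_def)

lemma Stirling_eq_coeff_X_over_ln:
  assumes "1 \<le> l" "l \<le> n"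
  shows "(of_nat (Stirling n l) :: 'a::field_char_0)
    = fact (n - 1) / fact (l - 1) * fps_nth (X_over_ln ^ n) (n - l)"
proof -
  let ?E = "fps_exp 1 - 1 :: 'a fps" and ?L = "fps_ln 1 :: 'a fps" and ?V = "X_over_ln :: 'a fps"
  obtain i where i: "l = Suc i"
    using assms by (cases l) auto
  obtain m where m: "n = Suc m"
    using assms by (cases n) auto
  have "?E oo ?L = fps_X"
    unfolding fps_ln_fps_exp_inv[of "1::'a", simplified] by (rule fps_inv_right) simp_all
  then have "?E ^ l oo ?L = fps_X ^ l"
    by (metis fps_compose_power fps_ln_0)
  \<comment> \<open>The chain rule, which produces the factor \<open>f'\<close> of the residue
    formula for \<open>f = ?L\<close>.\<close>
  then have "(fps_deriv (?E ^ l) oo ?L) * fps_deriv ?L = fps_deriv (fps_X ^ l)"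
    by (metis fps_compose_deriv fps_ln_0)
  also have "\<dots> = fps_const (of_nat l) * fps_X ^ i"
    by (simp add: i fps_deriv_power del: power_Suc)
  finally have d: "(fps_deriv (?E ^ l) oo ?L) * fps_deriv ?L = fps_const (of_nat l) * fps_X ^ i" .
  have "of_nat n * fps_nth (?E ^ l) n = fps_nth (fps_deriv (?E ^ l)) m"
    by (simp add: m)
  \<comment> \<open>Inversion at degree \<open>m = n - 1\<close> gives the power
    \<open>?V ^ n\<close>; the factor \<open>X^(l-1)\<close> then lowers the degree to
    \<open>n - l\<close>.\<close>
  also have "\<dots> = fps_nth ((fps_deriv (?E ^ l) oo ?L) * fps_deriv ?L * ?V ^ Suc m) m"
    by (rule residue_compose[OF fps_ln_eq_X_mult ln_quotient_mult_X_over_ln, symmetric])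
  also have "\<dots> = of_nat l * fps_nth (?V ^ n) (n - l)"
    using assms unfolding d mult.assoc fps_mult_left_const_nth fps_X_power_mult_nth
    by (simp add: i m)
  finally have "of_nat n * fps_nth (?E ^ l) n = of_nat l * fps_nth (?V ^ n) (n - l)" .
  then have "fact m * (of_nat n * fps_nth (?E ^ l) n) = fact m * (of_nat l * fps_nth (?V ^ n) (n - l))"
    by simp
  moreover have "fact m * (of_nat n * fps_nth (?E ^ l) n) = fact l * of_nat (Stirling n l)"
    unfolding Stirling_egf[symmetric] by (simp add: m algebra_simps)
  moreover have "(fact l :: 'a) = of_nat l * fact i"
    by (simp add: i)
  ultimately have "of_nat l * (fact i * of_nat (Stirling n l))
      = of_nat l * (fact m * fps_nth (?V ^ n) (n - l))"
    by (simp add: mult_ac)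
  then have "fact i * of_nat (Stirling n l) = fact m * fps_nth (?V ^ n) (n - l)"
    unfolding mult_cancel_left using assms by simp
  then show ?thesis
    by (simp add: i m field_simps)
qed

definition diag_bernoulli_gf :: "rat fps" where
  "diag_bernoulli_gf = Abs_fps (\<lambda>k. bernoulli_order k k / fact k)"

lemma one_plus_X_mult_diag_bernoulli_gf: "(1 + fps_X) * diag_bernoulli_gf = X_over_ln"
proof -
  let ?E = "fps_exp 1 - 1 :: rat fps" and ?u = "fps_shift 1 (fps_exp 1 - 1 :: rat fps)"
  \<comment> \<open>\<open>H = X / ((1 + X) * ln (1 + X))\<close> is the expected closed form of
    \<open>diag_bernoulli_gf\<close>.\<close>
  define H :: "rat fps" where "H = inverse (1 + fps_X) * X_over_ln"
  have E: "?E = fps_X * ?u"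
    by (rule fps_ext) (simp add: fps_X_mult_nth)
  have "fps_X * (?u * bernoulli_gf) = fps_X * 1"
    using bernoulli_gf_times E by (metis mult.assoc mult.commute mult_1_right)
  then have ub: "?u * bernoulli_gf = 1"
    by (simp only: mult_cancel_left) simp
  have oneX: "(1 + fps_X) * H = X_over_ln"
    unfolding H_def mult.assoc[symmetric] by (subst inverse_mult_eq_1') simp_all
  have "(1 + fps_X) * H * fps_ln 1 = fps_X"
    unfolding oneX using fps_ln_mult_X_over_ln[where ?'a = rat] by (simp add: mult.commute)
  \<comment> \<open>Substituting \<open>exp X - 1\<close> for \<open>X\<close> turns
    \<open>1 + X\<close> into \<open>exp X\<close> and \<open>ln (1 + X)\<close> into
    \<open>X\<close>.\<close>
  then have "((1 + fps_X) * H * fps_ln 1) oo ?E = fps_X oo ?E"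
    by simp
  moreover have "fps_ln 1 oo ?E = fps_X"
    unfolding fps_ln_fps_exp_inv[of "1::rat", simplified] by (rule fps_inv) simp_all
  ultimately have "fps_exp 1 * (H oo ?E) * fps_X = ?E"
    by (simp add: fps_compose_mult_distrib fps_compose_add_distrib)
  then have "fps_X * ((H oo ?E) * fps_exp 1) = fps_X * ?u"
    using E by (simp add: mult_ac)
  then have HE: "(H oo ?E) * fps_exp 1 = ?u"
    by (simp only: mult_cancel_left) simp
  have "fps_nth H n = fps_nth (bernoulli_gf ^ n) n" for n
  proof -
    \<comment> \<open>Here \<open>(H oo ?E) * ?E' = ?u\<close> cancels exactly one of the
      \<open>n + 1\<close> factors \<open>bernoulli_gf\<close>, leaving the diagonal
      coefficient.\<close>
    have "fps_nth H n = fps_nth ((H oo ?E) * fps_deriv ?E * bernoulli_gf ^ Suc n) n"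
      by (rule residue_compose[OF E ub, symmetric])
    also have "(H oo ?E) * fps_deriv ?E * bernoulli_gf ^ Suc n = (?u * bernoulli_gf) * bernoulli_gf ^ n"
      using HE by (simp add: mult.assoc)
    finally show ?thesis
      by (simp only: ub mult_1_left)
  qed
  then have "H = diag_bernoulli_gf"
    by (intro fps_ext) (simp add: diag_bernoulli_gf_def bernoulli_order_def)
  then show ?thesis
    using oneX by simp
qed

text \<open>The multinomial coefficient supplies the denominators \<open>fact (ls ! i)\<close> of
  the series coefficients, so the sum is an \<open>n\<close>-fold Cauchy product.\<close>

lemma sum_multinomial_bernoulli:
  assumes "n \<ge> 1"
  shows "(\<Sum>ls | length ls = n \<and> sum_list ls = k.
      multinomial k ls * (\<Prod>i<n. bernoulli_order (ls ! i) (ls ! i)))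
    = fact k * fps_nth (diag_bernoulli_gf ^ n) k"
proof -
  obtain m where m: "n = Suc m"
    using assms by (cases n) auto
  have "fps_nth (diag_bernoulli_gf ^ n) k
      = (\<Sum>ls | length ls = n \<and> sum_list ls = k. \<Prod>i<n. fps_nth diag_bernoulli_gf (ls ! i))"
    unfolding m fps_power_nth_Suc natpermute_def
    by (simp add: atLeast0AtMost lessThan_Suc_atMost)
  then show ?thesis
    by (simp add: sum_distrib_left diag_bernoulli_gf_def multinomial_def prod_dividef)
qed

lemma one_plus_fps_X_power_nth:
  "fps_nth ((1 + fps_X) ^ n :: 'a::comm_semiring_1 fps) k = of_nat (n choose k)"
proof -
  have "(1 + fps_X :: 'a fps) ^ n = (\<Sum>i\<le>n. fps_const (of_nat (n choose i)) * fps_X ^ i)"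
    using binomial_ring[of fps_X "1 :: 'a fps" n] by (simp add: add.commute fps_of_nat)
  then show ?thesis
    by (simp add: fps_sum_nth fps_X_power_nth if_distrib binomial_eq_0 cong: if_cong)
qed

text \<open>In factorials, \<open>m - 1\<close> and \<open>m - l\<close> cancel. What remains is a
  factor free of \<open>m\<close>, to be pulled out of the sum, and a coefficient of
  \<open>(1 + X)^n\<close>.\<close>

lemma binomial_coefficients_absorb:
  assumes "1 \<le> l" "l \<le> m" "m \<le> n"
  shows "of_nat ((n - 1) choose (m - 1)) * of_nat ((m - 1) choose (l - 1)) * (fact n / fact m) * fact (m - l)
    = (fact (n - 1) / fact (l - 1) * of_nat (n choose m) :: 'a::field_char_0)"
proof -
  obtain i where i: "l = Suc i"
    using assms by (cases l) auto
  obtain j where j: "m = Suc j"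
    using assms by (cases m) auto
  obtain k where k: "n = Suc k"
    using assms by (cases n) auto
  have "j \<le> k" "i \<le> j"
    using assms by (auto simp: i j k)
  then show ?thesis
    by (simp add: i j k binomial_fact field_simps del: of_nat_Suc binomial_Suc_Suc)
qed

theorem theorem8:
  fixes n l :: nat
  assumes "n \<ge> 1" and "1 \<le> l" and "l \<le> n"
  shows "of_nat (Stirling n l) =
    (\<Sum>m = l..n. \<Sum>ls | length ls = n \<and> sum_list ls = m - l.
      of_nat ((n - 1) choose (m - 1)) * of_nat ((m - 1) choose (l - 1)) *
      (fact n / fact m) * multinomial (m - l) ls *
      (\<Prod>i<n. bernoulli_order (ls ! i) (ls ! i)))"
proof -
  let ?c = "fact (n - 1) / fact (l - 1) :: rat"
  have inner: "(\<Sum>ls | length ls = n \<and> sum_list ls = m - l.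
      of_nat ((n - 1) choose (m - 1)) * of_nat ((m - 1) choose (l - 1)) *
      (fact n / fact m) * multinomial (m - l) ls *
      (\<Prod>i<n. bernoulli_order (ls ! i) (ls ! i)))
    = ?c * (of_nat (n choose m) * fps_nth (diag_bernoulli_gf ^ n) (m - l))"
    (is "?S = _") if "m \<in> {l..n}" for m
  proof -
    have "?S = of_nat ((n - 1) choose (m - 1)) * of_nat ((m - 1) choose (l - 1)) *
        (fact n / fact m) * (fact (m - l) * fps_nth (diag_bernoulli_gf ^ n) (m - l))"
      unfolding sum_multinomial_bernoulli[OF assms(1), symmetric] sum_distrib_left
      by (simp only: mult.assoc)
    also have "\<dots> = (?c * of_nat (n choose m)) * fps_nth (diag_bernoulli_gf ^ n) (m - l)"
      using that assms by (subst binomial_coefficients_absorb[symmetric]) (auto simp only: mult.assoc atLeastAtMost_iff)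
    finally show ?thesis
      by (simp only: mult.assoc)
  qed
  have "fps_nth (X_over_ln ^ n) (n - l) = fps_nth ((1 + fps_X) ^ n * diag_bernoulli_gf ^ n) (n - l)"
    by (simp add: one_plus_X_mult_diag_bernoulli_gf[symmetric] power_mult_distrib)
  also have "\<dots> = (\<Sum>i = 0..n - l. of_nat (n choose i) * fps_nth (diag_bernoulli_gf ^ n) (n - l - i))"
    by (simp add: fps_mult_nth one_plus_fps_X_power_nth)
  \<comment> \<open>With \<open>i = n - m\<close>, the index \<open>n - l - i\<close> becomes
    \<open>m - l\<close>, and the binomial coefficient is unchanged by symmetry.\<close>
  also have "\<dots> = (\<Sum>m = l..n. of_nat (n choose m) * fps_nth (diag_bernoulli_gf ^ n) (m - l))"
    by (rule sum.reindex_bij_witness[of _ "\<lambda>m. n - m" "\<lambda>i. n - i"])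
      (use assms in \<open>auto simp: binomial_symmetric[symmetric] add.commute\<close>)
  finally have "(of_nat (Stirling n l) :: rat)
      = ?c * (\<Sum>m = l..n. of_nat (n choose m) * fps_nth (diag_bernoulli_gf ^ n) (m - l))"
    using Stirling_eq_coeff_X_over_ln[OF assms(2,3), where ?'a = rat] by (simp only:)
  also have "\<dots> = (\<Sum>m = l..n. ?c * (of_nat (n choose m) * fps_nth (diag_bernoulli_gf ^ n) (m - l)))"
    by (rule sum_distrib_left)
  finally show ?thesis
    by (simp only: inner cong: sum.cong)
qed

end
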